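(* Let $d\ge 2$, let $j\in\{1,\dots,d\}$, and let $T^d=\operatorname{conv}\{e_1,\dots,e_{d+1}\}\subset\mathbb{R}^{d+1}$ be the regular $d$-simplex of edge length $\sqrt2$. Then $R_j(T^d)=\sqrt{\frac{j}{d+1}}$ if at least one of the following holds: (i) $d$ is odd; (ii) $j$ is even and $d\ne 2j$.
   Context: For a body $C$ (bounded, closed, convex set with nonempty interior) in $d$-dimensional Euclidean space and $1\le j\le d$, the outer $j$-radius is $R_j(C)=\min\{\rho\ge 0: C\subset E+\rho\mathbb{B}\text{ for some }(d-j)\text{-dimensional affine subspace }E\}$, where $\mathbb{B}$ is the Euclidean unit ball; equivalently, it is the smallest radius of a ball containing the orthogonal projection of $C$ onto some $j$-dimensional linear subspace. The simplex $T^d$ lies in the hyperplane $\{x\in\mathbb{R}^{d+1}:\sum_k x_k=1\}$ and is regarded as a body in this $d$-dimensional Euclidean space; so projections are taken onto $j$-dimensional subspaces of the parallel linear hyperplane $\{x\in\mathbb{R}^{d+1}:\sum_k x_k=0\}$. *)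

theory Defs
  imports "HOL-Analysis.Analysis"
begin

text \<open>
  The ambient Euclidean space of a body \<open>C\<close> is an affine set \<open>H\<close> containing \<open>C\<close>, so that a
  body lying in a hyperplane can be measured inside that hyperplane: the competing affine
  subspaces \<open>E\<close> have codimension \<open>j\<close> in \<open>H\<close>. It is harmless that the unit ball is taken in
  the surrounding vector space: for \<open>E \<subseteq> H\<close> and \<open>C \<subseteq> H\<close> only differences \<open>x - y\<close> with
  \<open>x \<in> C\<close> and \<open>y \<in> E\<close> matter, and these are parallel to \<open>H\<close>. \<open>LEAST\<close> is the minimum of a set
  of reals, and is unspecified if there is none.
\<close>

definition outer_radius :: "'a::euclidean_space set \<Rightarrow> nat \<Rightarrow> 'a set \<Rightarrow> real" where
  "outer_radius H j C = (LEAST \<rho>. \<rho> \<ge> 0 \<and>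
     (\<exists>E. affine E \<and> E \<subseteq> H \<and> aff_dim E = aff_dim H - int j \<and>
          C \<subseteq> {y + \<rho> *\<^sub>R u |y u. y \<in> E \<and> u \<in> cball 0 1}))"

definition simplex_hyperplane :: "(real ^ 'n) set" where
  "simplex_hyperplane = {x. (\<Sum>k\<in>UNIV. x $ k) = 1}"

text \<open>With \<open>d + 1 = CARD('n)\<close>, this is the regular \<open>d\<close>-simplex of edge length \<open>sqrt 2\<close>.\<close>

definition regular_simplex :: "(real ^ 'n) set" where
  "regular_simplex = convex hull (range (\<lambda>k. axis k 1))"

end

theory Submission
  imports Defs
begin

text \<open>
  Let \<open>n = d + 1\<close>. If the projection of the simplex onto a \<open>j\<close>-dimensional space \<open>L\<close> lies in a ball
  of radius \<open>\<rho>\<close> with centre \<open>p\<close>, then summing over the vertices gives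
  \<open>n \<rho>\<^sup>2 \<ge> (\<Sum>k. (norm (P e\<^sub>k - p))\<^sup>2) \<ge> (\<Sum>k. (norm (P e\<^sub>k))\<^sup>2) = trace P = j\<close>, since the
  projected vertices have mean zero. Equality holds as soon as all \<open>P e\<^sub>k\<close> have the same norm.
  Such an \<open>L\<close> is spanned by the discrete Hartley vectors with entries
  \<open>(cos (2\<pi>mk/n) + sin (2\<pi>mk/n)) / sqrt n\<close>, where \<open>m\<close> runs over a set of \<open>j\<close> frequencies in
  \<open>{1..<n}\<close> invariant under \<open>m \<mapsto> n - m\<close>: then
  \<open>(norm (P e\<^sub>k))\<^sup>2 = (\<Sum>m. (1 + sin (4\<pi>mk/n)) / n) = j / n\<close>. An invariant set of \<open>j\<close> frequencies
  exists if \<open>j\<close> is even or the self-paired frequency \<open>n/2\<close> is available.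
\<close>

subsection \<open>Orthonormal families\<close>

text \<open>\<open>p x\<close> is the orthogonal projection of \<open>x\<close> onto the span of the
  family. Bessel's inequality is the nonnegativity of \<open>(x - p x) \<bullet> (x - p x)\<close>,
  where \<open>p x \<bullet> x\<close> and \<open>p x \<bullet> p x\<close> agree.\<close>

lemma orthonormal_expansion:
  fixes u :: "'i \<Rightarrow> 'a::real_inner"
  assumes "finite I"
    and orth: "\<And>i k. i \<in> I \<Longrightarrow> k \<in> I \<Longrightarrow> u i \<bullet> u k = (if i = k then 1 else 0)"
  defines "p \<equiv> \<lambda>x. \<Sum>i\<in>I. (u i \<bullet> x) *\<^sub>R u i"
  shows inner_orthonormal_expansion: "i \<in> I \<Longrightarrow> u i \<bullet> p x = u i \<bullet> x"
    and norm_orthonormal_expansion: "(norm (p x))\<^sup>2 = (\<Sum>i\<in>I. (u i \<bullet> x)\<^sup>2)"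
    and Bessel_inequality: "(\<Sum>i\<in>I. (u i \<bullet> x)\<^sup>2) \<le> (norm x)\<^sup>2"
proof -
  have inner_p: "u i \<bullet> p x = u i \<bullet> x" if "i \<in> I" for i x
  proof -
    have "u i \<bullet> p x = (\<Sum>k\<in>I. if i = k then u k \<bullet> x else 0)"
      unfolding p_def inner_sum_right using orth that by (intro sum.cong) auto
    then show ?thesis
      using \<open>finite I\<close> that by simp
  qed
  then show "i \<in> I \<Longrightarrow> u i \<bullet> p x = u i \<bullet> x" .
  have *: "p x \<bullet> y = (\<Sum>i\<in>I. (u i \<bullet> x) * (u i \<bullet> y))" for y
    by (simp add: p_def inner_sum_left)
  have **: "p x \<bullet> p x = (\<Sum>i\<in>I. (u i \<bullet> x)\<^sup>2)"
    unfolding * by (intro sum.cong) (auto simp: inner_p power2_eq_square)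
  then show "(norm (p x))\<^sup>2 = (\<Sum>i\<in>I. (u i \<bullet> x)\<^sup>2)"
    by (simp add: power2_norm_eq_inner)
  have "0 \<le> (x - p x) \<bullet> (x - p x)"
    by simp
  also have "\<dots> = x \<bullet> x - 2 * (p x \<bullet> x) + p x \<bullet> p x"
    by (simp add: inner_diff_left inner_diff_right inner_commute)
  also have "p x \<bullet> x = (\<Sum>i\<in>I. (u i \<bullet> x)\<^sup>2)"
    unfolding * by (simp add: power2_eq_square)
  finally show "(\<Sum>i\<in>I. (u i \<bullet> x)\<^sup>2) \<le> (norm x)\<^sup>2"
    using ** by (simp add: power2_norm_eq_inner)
qed

lemma dim_orthogonal_complement:
  fixes S :: "'a::euclidean_space set"
  shows "dim {y. \<forall>x\<in>S. x \<bullet> y = 0} + dim S = DIM('a)"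
proof -
  have "{y. \<forall>x\<in>S. x \<bullet> y = 0} = {y \<in> UNIV. \<forall>x\<in>span S. orthogonal x y}"
    by (auto simp: orthogonal_def span_base)
       (metis orthogonal_commute orthogonal_def orthogonal_to_span)
  then show ?thesis
    using dim_subspace_orthogonal_to_vectors[of "span S" UNIV] by (simp add: dim_UNIV)
qed

subsection \<open>The outer radii of the regular simplex\<close>

lemma simplex_hyperplane_eq: "simplex_hyperplane = {x :: real ^ 'n. 1 \<bullet> x = 1}"
  by (simp add: simplex_hyperplane_def inner_vec_def)

lemma aff_dim_simplex_hyperplane:
  "aff_dim (simplex_hyperplane :: (real ^ 'n) set) = int (CARD('n)) - 1"
  by (simp add: simplex_hyperplane_eq)

text \<open>The lower bound: averaging the squared distances of the vertices from \<open>E\<close>,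
  where each of \<open>j\<close> orthonormal directions normal to \<open>E\<close> contributes at
  least 1 to the sum.\<close>

lemma regular_simplex_width_ge:
  fixes E :: "(real ^ 'n) set"
  assumes E: "affine E" "E \<subseteq> simplex_hyperplane"
    and dimE: "aff_dim E = aff_dim (simplex_hyperplane :: (real ^ 'n) set) - int j"
    and j: "j < CARD('n)"
    and cover: "regular_simplex \<subseteq> {y + \<rho> *\<^sub>R u |y u. y \<in> E \<and> u \<in> cball 0 1}"
    and "\<rho> \<ge> 0"
  shows "sqrt (real j / real CARD('n)) \<le> \<rho>"
proof -
  \<comment> \<open>The empty set has affine dimension -1, whereas \<open>j < CARD('n)\<close> makes
    \<open>aff_dim E\<close> nonnegative.\<close>
  have "E \<noteq> {}"
    using dimE j by (auto simp: aff_dim_simplex_hyperplane)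
  then obtain a where a: "a \<in> E" by auto
  define V where "V = (\<lambda>x. x - a) ` E"
  have dimV: "int (dim V) = int (CARD('n)) - 1 - int j"
    using aff_dim_eq_dim_subtract[of a E] a dimE
    by (simp add: V_def hull_inc aff_dim_simplex_hyperplane)
  have V1: "1 \<bullet> v = 0" if "v \<in> V" for v
  proof -
    have "1 \<bullet> x = 1" if "x \<in> E" for x
      using that E(2) by (auto simp: simplex_hyperplane_eq)
    then show ?thesis
      using that a by (auto simp: V_def inner_diff_right)
  qed
  \<comment> \<open>Inserting the all-ones vector \<open>1\<close> keeps \<open>L\<close> inside the
    linear hyperplane, so \<open>L\<close> is the complement of the direction space \<open>V\<close>
    there and has dimension \<open>j\<close>.\<close>
  define L where "L = {y. \<forall>x\<in>insert 1 V. x \<bullet> y = 0}"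
  have "1 \<notin> span V"
  proof
    assume "1 \<in> span V"
    then have "orthogonal 1 (1 :: real ^ 'n)"
      by (rule orthogonal_to_span) (use V1 in \<open>auto simp: orthogonal_def\<close>)
    then show False by (simp add: orthogonal_def inner_vec_def)
  qed
  then have "dim (insert 1 V) = dim V + 1"
    by (simp add: dim_insert)
  then have dimL: "dim L = j"
    using dim_orthogonal_complement[of "insert 1 V"] dimV by (simp add: L_def)
  have "subspace L"
    by (auto simp: L_def subspace_def inner_add_right)
  then obtain B where B: "B \<subseteq> L" "pairwise orthogonal B" "\<And>x. x \<in> B \<Longrightarrow> norm x = 1"
      and "independent B" "card B = dim L"
    using orthonormal_basis_subspace by metis
  have "finite B" using \<open>independent B\<close> independent_imp_finite by blast
  have orth: "b \<bullet> c = (if b = c then 1 else 0)" if "b \<in> B" "c \<in> B" for b c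
    using B that by (auto simp: pairwise_def orthogonal_def norm_eq_1)
  \<comment> \<open>All points of \<open>E\<close> share the coordinate \<open>b \<bullet> a\<close>
    along \<open>b\<close>, so the terms are squared coordinates of the displacement from
    \<open>E\<close> to the vertex.\<close>
  have "(\<Sum>b\<in>B. (b $ k - b \<bullet> a)\<^sup>2) \<le> \<rho>\<^sup>2" for k
  proof -
    have "axis k 1 \<in> (regular_simplex :: (real ^ 'n) set)"
      by (auto simp: regular_simplex_def hull_inc)
    then obtain y u where yu: "axis k 1 = y + \<rho> *\<^sub>R u" "y \<in> E" "norm u \<le> 1"
      using cover by force
    have "b $ k - b \<bullet> a = b \<bullet> (\<rho> *\<^sub>R u)" if "b \<in> B" for b
    proof -
      have "y - a \<in> V" using yu by (auto simp: V_def)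
      then have "b \<bullet> (y - a) = 0"
        using B(1) that by (auto simp: L_def inner_commute)
      moreover have "b $ k = b \<bullet> (y + \<rho> *\<^sub>R u)"
        using yu(1) by (simp add: cart_eq_inner_axis)
      ultimately show ?thesis by (simp add: inner_diff_right inner_add_right)
    qed
    then have "(\<Sum>b\<in>B. (b $ k - b \<bullet> a)\<^sup>2) = (\<Sum>b\<in>B. (b \<bullet> (\<rho> *\<^sub>R u))\<^sup>2)"
      by simp
    also have "\<dots> \<le> (norm (\<rho> *\<^sub>R u))\<^sup>2"
      by (rule Bessel_inequality) (use \<open>finite B\<close> orth in auto)
    also have "\<dots> \<le> \<rho>\<^sup>2"
      using yu(3) \<open>\<rho> \<ge> 0\<close> by (simp add: power_mult_distrib mult_left_le power_le_one)
    finally show ?thesis .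
  qed
  then have "(\<Sum>k\<in>(UNIV :: 'n set). \<Sum>b\<in>B. (b $ k - b \<bullet> a)\<^sup>2) \<le> (\<Sum>k\<in>(UNIV :: 'n set). \<rho>\<^sup>2)"
    by (intro sum_mono)
  moreover have "real j \<le> (\<Sum>k\<in>(UNIV :: 'n set). \<Sum>b\<in>B. (b $ k - b \<bullet> a)\<^sup>2)"
  proof -
    have "1 \<le> (\<Sum>k\<in>UNIV. (b $ k - b \<bullet> a)\<^sup>2)" if "b \<in> B" for b
    proof -
      have s0: "(\<Sum>k\<in>UNIV. b $ k) = 0"
        using that B(1) by (auto simp: L_def inner_vec_def)
      have s1: "(\<Sum>k\<in>UNIV. (b $ k)\<^sup>2) = 1"
        using orth[OF that that] by (simp add: inner_vec_def power2_eq_square)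
      \<comment> \<open>The cross term vanishes because \<open>b\<close> is orthogonal to
        \<open>1\<close>; what remains is 1 plus a square.\<close>
      have "(\<Sum>k\<in>UNIV. (b $ k - b \<bullet> a)\<^sup>2)
          = (\<Sum>k\<in>UNIV. (b $ k)\<^sup>2) - 2 * (b \<bullet> a) * (\<Sum>k\<in>UNIV. b $ k)
            + real CARD('n) * (b \<bullet> a)\<^sup>2"
        by (simp add: power2_diff sum.distrib sum_subtractf sum_distrib_left mult_ac)
      then show ?thesis using s0 s1 by simp
    qed
    then have "(\<Sum>b\<in>B. 1) \<le> (\<Sum>b\<in>B. \<Sum>k\<in>(UNIV :: 'n set). (b $ k - b \<bullet> a)\<^sup>2)"
      by (intro sum_mono)
    then show ?thesis
      using \<open>card B = dim L\<close> dimL by (simp add: sum.swap[of _ B])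
  qed
  ultimately have "real j / real CARD('n) \<le> \<rho>\<^sup>2"
    by (simp add: field_simps)
  then show ?thesis
    using \<open>\<rho> \<ge> 0\<close> real_le_lsqrt by blast
qed

text \<open>Reduces the theorem to finding a suitable orthonormal family: the sum in
  \<open>diag\<close> is the squared length of the projected vertex, so all vertices are equally far
  from \<open>E\<close> and the averaged lower bound is attained.\<close>

lemma outer_radius_regular_simplex_eqI:
  fixes u :: "'i \<Rightarrow> real ^ 'n"
  assumes "finite M"
    and orth: "\<And>l m. l \<in> M \<Longrightarrow> m \<in> M \<Longrightarrow> u l \<bullet> u m = (if l = m then 1 else 0)"
    and mean: "\<And>m. m \<in> M \<Longrightarrow> 1 \<bullet> u m = 0"
    and diag: "\<And>k. (\<Sum>m\<in>M. (u m $ k)\<^sup>2) = real (card M) / real CARD('n)"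
  shows "outer_radius (simplex_hyperplane :: (real ^ 'n) set) (card M) regular_simplex
         = sqrt (real (card M) / real CARD('n))"
proof -
  define \<rho> where "\<rho> = sqrt (real (card M) / real CARD('n))"
  define E where "E = {x :: real ^ 'n. 1 \<bullet> x = 1 \<and> (\<forall>m\<in>M. u m \<bullet> x = 0)}"
  have norm1: "norm (u m) = 1" if "m \<in> M" for m
    using orth[OF that that] by (simp add: norm_eq_1)
  have inj: "inj_on u M"
    by (rule inj_onI) (metis orth zero_neq_one)
  have one_notin: "1 \<notin> u ` M"
  proof
    assume "1 \<in> u ` M"
    then obtain m where "m \<in> M" "u m = 1" by (metis imageE)
    then show False using mean[of m] by (simp add: inner_vec_def)
  qed
  have indep: "independent (insert 1 (u ` M))"
  proof (rule pairwise_orthogonal_independent)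
    show "pairwise orthogonal (insert 1 (u ` M))"
      using orth mean by (auto simp: pairwise_def orthogonal_def inner_commute)
    show "0 \<notin> insert 1 (u ` M)"
      using norm1 by (metis imageE insertE norm_zero zero_neq_one)
  qed
  have "dim (insert 1 (u ` M)) = card M + 1"
    using dim_eq_card_independent[OF indep] one_notin inj \<open>finite M\<close>
    by (simp add: card_image)
  then have dimW: "dim {y. \<forall>x\<in>insert 1 (u ` M). x \<bullet> y = 0} + (card M + 1) = CARD('n)"
    using dim_orthogonal_complement[of "insert 1 (u ` M)"] by simp
  then have j: "card M < CARD('n)" by linarith

  have affE: "affine E"
    unfolding affine_def E_def
    by (auto simp: inner_add_right)
  have subE: "E \<subseteq> simplex_hyperplane"
    by (auto simp: E_def simplex_hyperplane_eq)
  \<comment> \<open>The centroid of the simplex lies in \<open>E\<close>; translating it to the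
    origin turns \<open>E\<close> into the linear complement of \<open>1\<close> and all
    \<open>u m\<close>.\<close>
  define c :: "real ^ 'n" where "c = (1 / real CARD('n)) *\<^sub>R 1"
  have c: "1 \<bullet> c = 1" "\<And>m. m \<in> M \<Longrightarrow> u m \<bullet> c = 0"
    using mean by (simp add: c_def inner_vec_def, simp add: c_def inner_commute[of _ 1])
  then have "c \<in> E" by (simp add: E_def)
  have "(\<lambda>x. x - c) ` E = {y. \<forall>x\<in>insert 1 (u ` M). x \<bullet> y = 0}"
  proof (intro equalityI subsetI)
    fix y assume "y \<in> {y. \<forall>x\<in>insert 1 (u ` M). x \<bullet> y = 0}"
    then have "y + c \<in> E"
      using c by (auto simp: E_def inner_add_right)
    then show "y \<in> (\<lambda>x. x - c) ` E"
      by (metis add_diff_cancel_right' image_eqI)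
  qed (use c in \<open>auto simp: E_def inner_diff_right\<close>)
  then have dimE: "aff_dim E = aff_dim (simplex_hyperplane :: (real ^ 'n) set) - int (card M)"
    using aff_dim_eq_dim_subtract[of c E] \<open>c \<in> E\<close> dimW
    by (simp add: hull_inc aff_dim_simplex_hyperplane)

  have cover: "regular_simplex \<subseteq> {y + \<rho> *\<^sub>R v |y v. y \<in> E \<and> v \<in> cball 0 1}"
    unfolding regular_simplex_def
  \<comment> \<open>The neighbourhood of \<open>E\<close> is a linear image of a product of convex
    sets, so only the vertices need checking.\<close>
  proof (rule hull_minimal)
    have "{y + \<rho> *\<^sub>R v |y v. y \<in> E \<and> v \<in> cball 0 1} = (\<lambda>(y, v). y + \<rho> *\<^sub>R v) ` (E \<times> cball 0 1)"
      by auto blast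
    moreover have "linear (\<lambda>(y :: real ^ 'n, v). y + \<rho> *\<^sub>R v)"
      by (rule linearI) (auto simp: algebra_simps)
    ultimately show "convex {y + \<rho> *\<^sub>R v |y v. y \<in> E \<and> v \<in> cball 0 1}"
      by (simp add: convex_linear_image convex_Times affine_imp_convex affE)
    show "range (\<lambda>k. axis k 1) \<subseteq> {y + \<rho> *\<^sub>R v |y v. y \<in> E \<and> v \<in> cball 0 1}"
    proof
      fix e :: "real ^ 'n" assume "e \<in> range (\<lambda>k. axis k 1)"
      then obtain k where e: "e = axis k 1" by auto
      define p where "p = (\<Sum>m\<in>M. (u m \<bullet> e) *\<^sub>R u m)"
      have "1 \<bullet> p = 0"
        using mean by (simp add: p_def inner_sum_right)
      moreover have "1 \<bullet> e = 1"
        by (simp add: e inner_axis)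
      moreover have "u m \<bullet> p = u m \<bullet> e" if "m \<in> M" for m
        unfolding p_def by (rule inner_orthonormal_expansion) (use \<open>finite M\<close> orth that in auto)
      ultimately have "e - p \<in> E"
        by (simp add: E_def inner_diff_right)
      have "(norm p)\<^sup>2 = (\<Sum>m\<in>M. (u m \<bullet> e)\<^sup>2)"
        unfolding p_def by (rule norm_orthonormal_expansion) (use \<open>finite M\<close> orth in auto)
      also have "\<dots> = real (card M) / real CARD('n)"
        using diag[of k] by (simp add: e inner_axis)
      finally have np: "norm p = \<rho>"
        unfolding \<rho>_def by (metis norm_ge_zero real_sqrt_unique)
      \<comment> \<open>If \<open>\<rho> = 0\<close> then \<open>p = 0\<close>, and
        \<open>1 / 0 = 0\<close> makes the scaled vector \<open>0\<close>, which is still in the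
        ball.\<close>
      have "p = \<rho> *\<^sub>R ((1 / \<rho>) *\<^sub>R p)"
        using np by (cases "\<rho> = 0") auto
      moreover have "(1 / \<rho>) *\<^sub>R p \<in> cball 0 1"
        using np by (cases "\<rho> = 0") auto
      moreover have "e = (e - p) + p" by simp
      ultimately show "e \<in> {y + \<rho> *\<^sub>R v |y v. y \<in> E \<and> v \<in> cball 0 1}"
        using \<open>e - p \<in> E\<close> by (smt (verit) mem_Collect_eq)
    qed
  qed
  have "outer_radius (simplex_hyperplane :: (real ^ 'n) set) (card M) regular_simplex = \<rho>"
    unfolding outer_radius_def
  proof (rule Least_equality)
    show "0 \<le> \<rho> \<and> (\<exists>E :: (real ^ 'n) set. affine E \<and> E \<subseteq> simplex_hyperplane \<and>
        aff_dim E = aff_dim (simplex_hyperplane :: (real ^ 'n) set) - int (card M) \<and>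
        regular_simplex \<subseteq> {y + \<rho> *\<^sub>R u |y u. y \<in> E \<and> u \<in> cball 0 1})"
      using affE subE dimE cover by (intro conjI exI[of _ E]) (simp_all add: \<rho>_def)
  qed (use regular_simplex_width_ge j in \<open>auto simp: \<rho>_def\<close>)
  then show ?thesis by (simp add: \<rho>_def)
qed

subsection \<open>The discrete Hartley basis\<close>

text \<open>A geometric sum with ratio \<open>w\<close> satisfying \<open>w ^ n = 1\<close>; the
  bound on \<open>k\<close> excludes \<open>w = 1\<close> unless \<open>k = 0\<close>.\<close>

lemma sum_cis_roots_unity:
  fixes k :: int
  assumes "\<bar>k\<bar> < int n"
  shows "(\<Sum>t<n. cis (2 * pi * k * real t / n)) = (if k = 0 then of_nat n else 0)"
proof (cases "k = 0")
  case False
  define w where "w = cis (2 * pi * k / n)"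
  have "n > 0" using assms by linarith
  have "w \<noteq> 1"
  proof
    assume "w = 1"
    then have "cos (2 * pi * k / n) = 1"
      by (simp add: w_def complex_eq_iff)
    then obtain i :: int where "2 * pi * k / n = real_of_int i * 2 * pi"
      using cos_one_2pi_int by blast
    then have "real_of_int k = real_of_int (i * int n)"
      using \<open>n > 0\<close> by (simp add: field_simps)
    then have "k = i * int n" by linarith
    then have "int n dvd k" by simp
    then show False
      using assms False zdvd_not_zless[of "\<bar>k\<bar>" "int n"] by simp
  qed
  have "w ^ n = cis (real n * (2 * pi * k / n))"
    by (simp only: w_def Complex.DeMoivre)
  also have "real n * (2 * pi * k / n) = 2 * pi * k"
    using \<open>n > 0\<close> by simp
  also have "cis (2 * pi * k) = 1"
    by (rule cis_multiple_2pi) simp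
  finally have "w ^ n = 1" .
  have "(\<Sum>t<n. cis (2 * pi * k * real t / n)) = (\<Sum>t<n. w ^ t)"
    by (simp add: w_def Complex.DeMoivre mult_ac)
  also have "\<dots> = 0"
    using \<open>w \<noteq> 1\<close> \<open>w ^ n = 1\<close> by (simp add: sum_gp_strict)
  finally show ?thesis using False by simp
qed simp

lemma sum_cos_roots_unity:
  fixes k :: int
  assumes "\<bar>k\<bar> < int n"
  shows "(\<Sum>t<n. cos (2 * pi * k * real t / n)) = (if k = 0 then real n else 0)"
  using arg_cong[OF sum_cis_roots_unity[OF assms], of Re] by simp

text \<open>Stated for every integer \<open>k\<close> because it is applied to \<open>l + m\<close>,
  which may reach or exceed \<open>n\<close>; reducing \<open>k\<close> modulo \<open>n\<close>
  changes no term.\<close>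

lemma sum_sin_roots_unity:
  fixes k :: int and n :: nat
  shows "(\<Sum>t<n. sin (2 * pi * k * real t / n)) = 0"
proof (cases "n = 0")
  case False
  define r where "r = k mod int n"
  have r: "\<bar>r\<bar> < int n" using False by (simp add: r_def)
  have "k = r + int n * (k div int n)" by (simp add: r_def)
  then have k: "real_of_int k = r + n * real_of_int (k div int n)"
    by (metis of_int_add of_int_mult of_int_of_nat_eq)
  have "sin (2 * pi * k * t / n) = sin (2 * pi * r * t / n)" for t :: nat
  proof -
    define q where "q = k div int n * int t"
    have "2 * pi * k * t / n = 2 * pi * r * t / n + 2 * pi * of_int q"
      unfolding k q_def using False by (simp add: field_simps)
    then show ?thesis
      by (simp only: sin_add sin_int_2pin cos_int_2pin)
  qed
  then show ?thesis
    using arg_cong[OF sum_cis_roots_unity[OF r], of Im] by simp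
qed simp

text \<open>The normalised real counterpart of the discrete Fourier kernel, with frequency
  \<open>m\<close> and sample point \<open>t\<close>.\<close>

definition hartley :: "nat \<Rightarrow> nat \<Rightarrow> nat \<Rightarrow> real" where
  "hartley n m t = (cos (2 * pi * m * t / n) + sin (2 * pi * m * t / n)) / sqrt n"

text \<open>The cosine of the difference yields orthonormality; for \<open>l = m\<close> the formula
  gives the squared entry as a constant plus a sine.\<close>

lemma hartley_mult:
  "hartley n l t * hartley n m t =
    (cos (2 * pi * (int l - int m) * t / n) + sin (2 * pi * (int l + int m) * t / n)) / n"
proof -
  define a b where "a = 2 * pi * l * t / n" and "b = 2 * pi * m * t / n"
  have "2 * pi * (int l - int m) * t / n = a - b" "2 * pi * (int l + int m) * t / n = a + b"
    by (simp_all add: a_def b_def diff_divide_distrib add_divide_distrib algebra_simps)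
  moreover have "(cos a + sin a) * (cos b + sin b) = cos (a - b) + sin (a + b)"
    by (simp add: cos_diff sin_add algebra_simps)
  moreover have "hartley n l t * hartley n m t = (cos a + sin a) * (cos b + sin b) / n"
    by (simp add: hartley_def a_def b_def)
  ultimately show ?thesis
    by (simp only:)
qed

lemma hartley_orthonormal:
  assumes "l < n" "m < n"
  shows "(\<Sum>t<n. hartley n l t * hartley n m t) = (if l = m then 1 else 0)"
proof -
  have "\<bar>int l - int m\<bar> < int n" using assms by linarith
  then show ?thesis
    using sum_cos_roots_unity[of "int l - int m" n] sum_sin_roots_unity[of "int l + int m" n] assms
    by (simp add: hartley_mult sum.distrib flip: sum_divide_distrib)
qed

text \<open>Orthogonality to frequency 0, whose vector is constant.\<close>

lemma sum_hartley_eq_0: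
  assumes "0 < m" "m < n"
  shows "(\<Sum>t<n. hartley n m t) = 0"
proof -
  have "(\<Sum>t<n. hartley n 0 t * hartley n m t) = 0"
    using hartley_orthonormal[of 0 n m] assms by simp
  then show ?thesis
    using assms by (simp add: hartley_def flip: sum_divide_distrib)
qed

text \<open>The substitution \<open>m\<close> to \<open>n - m\<close> preserves \<open>M\<close> and
  negates the sine part of each square, so the sine parts sum to zero.\<close>

lemma sum_hartley_square:
  fixes n :: nat
  assumes "n > 0" and M: "\<And>m. m \<in> M \<Longrightarrow> m \<le> n \<and> n - m \<in> M"
  shows "(\<Sum>m\<in>M. (hartley n m t)\<^sup>2) = real (card M) / n"
proof -
  define s where "s m = sin (2 * pi * (int m + int m) * t / n)" for m
  have "bij_betw (\<lambda>m. n - m) M M"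
    by (rule bij_betw_byWitness[where f' = "\<lambda>m. n - m"]) (use M in auto)
  then have "(\<Sum>m\<in>M. s m) = (\<Sum>m\<in>M. s (n - m))"
    by (rule sum.reindex_bij_betw[symmetric])
  also have "\<dots> = (\<Sum>m\<in>M. - s m)"
  proof (rule sum.cong)
    fix m assume "m \<in> M"
    then have "2 * pi * (int (n - m) + int (n - m)) * t / n
        = 2 * pi * of_int (2 * int t) - 2 * pi * (int m + int m) * t / n"
      using M \<open>n > 0\<close> by (simp add: field_simps of_nat_diff)
    then show "s (n - m) = - s m"
      unfolding s_def by (simp only: sin_diff sin_int_2pin cos_int_2pin)
  qed simp
  finally have "(\<Sum>m\<in>M. s m) = 0"
    by (simp add: sum_negf)
  moreover have "(\<Sum>m\<in>M. (hartley n m t)\<^sup>2) = (\<Sum>m\<in>M. (1 + s m) / n)"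
    by (simp add: power2_eq_square hartley_mult s_def)
  ultimately show ?thesis
    by (simp add: sum.distrib flip: sum_divide_distrib)
qed

lemma exists_symmetric_frequencies:
  fixes n j :: nat
  assumes "j < n" "even n \<or> even j"
  obtains M where "M \<subseteq> {1..<n}" "card M = j" "\<And>m. m \<in> M \<Longrightarrow> n - m \<in> M"
proof (cases "even j")
  case True
  then obtain i where i: "j = 2 * i" by blast
  \<comment> \<open>The \<open>i\<close> lowest and \<open>i\<close> highest frequencies, disjoint
    because \<open>2 * i < n\<close>.\<close>
  let ?M = "{1..i} \<union> {n - i..<n}"
  have "card ?M = j"
    using assms i by (subst card_Un_disjoint) auto
  then show ?thesis
    using assms i by (intro that[of ?M]) auto
next
  case False
  then obtain i h where "j = 2 * i + 1" "n = 2 * h"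
    using assms by (metis evenE oddE)
  then show ?thesis
    \<comment> \<open>For odd \<open>j\<close> the number \<open>n\<close> is even, and an interval
      centred at the self-paired frequency \<open>h\<close> is symmetric of odd size.\<close>
    using assms by (intro that[of "{h - i..h + i}"]) auto
qed

theorem theorem2p13:
  fixes d j :: nat
  assumes "d \<ge> 2" and "j \<in> {1..d}"
    and "CARD('n::finite) = d + 1"
    and "odd d \<or> (even j \<and> d \<noteq> 2 * j)"
  shows "outer_radius (simplex_hyperplane :: (real ^ 'n) set) j regular_simplex
         = sqrt (real j / real (d + 1))"
proof -
  define n where "n = d + 1"
  have "j < n" "even n \<or> even j"
    using assms by (auto simp: n_def)
  then obtain M where M: "M \<subseteq> {1..<n}" "card M = j" "\<And>m. m \<in> M \<Longrightarrow> n - m \<in> M"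
    using exists_symmetric_frequencies by blast
  \<comment> \<open>Numbers the coordinates by the sample points \<open>0, ..., n - 1\<close> of the
    Hartley vectors.\<close>
  obtain f :: "'n \<Rightarrow> nat" where f: "bij_betw f UNIV {..<n}"
    using assms(3) ex_bij_betw_finite_nat[of "UNIV :: 'n set"] by (auto simp: n_def atLeast0LessThan)
  define u :: "nat \<Rightarrow> real ^ 'n" where "u m = (\<chi> k. hartley n m (f k))" for m
  have range: "0 < m \<and> m < n" if "m \<in> M" for m
    using that M(1) by auto
  note reindex = sum.reindex_bij_betw[OF f]
  have "outer_radius (simplex_hyperplane :: (real ^ 'n) set) (card M) regular_simplex
      = sqrt (real (card M) / real CARD('n))"
  proof (rule outer_radius_regular_simplex_eqI)
    show "finite M"
      using M(1) finite_subset by blast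
    show "u l \<bullet> u m = (if l = m then 1 else 0)" if "l \<in> M" "m \<in> M" for l m
      using hartley_orthonormal[of l n m] reindex[of "\<lambda>t. hartley n l t * hartley n m t"] that range
      by (simp add: inner_vec_def u_def)
    show "1 \<bullet> u m = 0" if "m \<in> M" for m
      using sum_hartley_eq_0[of m n] reindex[of "hartley n m"] that range
      by (simp add: inner_vec_def u_def)
    show "(\<Sum>m\<in>M. (u m $ k)\<^sup>2) = real (card M) / real CARD('n)" for k
      using sum_hartley_square[of n M "f k"] M assms(3) by (fastforce simp: u_def n_def)
  qed
  then show ?thesis
    using M(2) assms(3) by simp
qed

end
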